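(* For every integer $n\ge 2$ let $Q_n(x)=-\int_x^1 L_{n-1}(t)\,dt$, where $L_{n-1}$ is the Legendre polynomial of degree $n-1$ normalized by $L_{n-1}(1)=1$. Then the polynomials $Q_n$ are orthogonal on $[-1,1]$ with respect to the weight function $w(x)=\frac{1}{1-x^2}$, that is, for all integers $n,m\ge 2$ with $n\neq m$, $$\int_{-1}^{1}\frac{Q_n(x)Q_m(x)}{1-x^2}\,dx=0,$$ and for every integer $n\ge 2$, $$\|Q_n\|^2:=\int_{-1}^{1}\frac{Q_n(x)^2}{1-x^2}\,dx=\frac{2}{n(n-1)(2n-1)}.$$
   Context: The Legendre polynomials are $L_n(x)=\frac{1}{2^n n!}\frac{d^n}{dx^n}(x^2-1)^n$, so that $L_n(1)=1$ for all $n\ge 0$. For $n\ge 2$ the polynomial $Q_n$ has degree $n$ and vanishes at $x=\pm1$. *)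

theory Defs
  imports "HOL-Analysis.Analysis" "HOL-Computational_Algebra.Polynomial"
begin

definition legendre_poly :: "nat \<Rightarrow> real poly" where
  "legendre_poly n = smult (1 / (2 ^ n * fact n)) ((pderiv ^^ n) ([:-1, 0, 1:] ^ n))"

text \<open>
  The interval integral is oriented, so \<open>Q_fun n\<close> is a polynomial function on the whole
  real line, not only for \<open>x \<le> 1\<close>. Only indices \<open>n \<ge> 2\<close> are meaningful.
\<close>

definition Q_fun :: "nat \<Rightarrow> real \<Rightarrow> real" where
  "Q_fun n x = - (LBINT t=ereal x..ereal 1. poly (legendre_poly (n - 1)) t)"

end

theory Submission
  imports Defs
begin

text \<open>
  The operator \<open>T p = ((x\<^sup>2 - 1) p')'\<close> is symmetric on \<open>[-1, 1]\<close>, and \<open>T L\<^sub>k = k (k + 1) L\<^sub>k\<close>. The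
  eigenvalue equation identifies \<open>Q\<^sub>n\<close> with \<open>(x\<^sup>2 - 1) L\<^sub>n\<^sub>-\<^sub>1' / (n (n - 1))\<close>, so the weight cancels one
  factor \<open>1 - x\<^sup>2\<close> of \<open>Q\<^sub>n Q\<^sub>m\<close> and an integration by parts leaves a multiple of
  \<open>\<integral> L\<^sub>n\<^sub>-\<^sub>1 L\<^sub>m\<^sub>-\<^sub>1\<close>. Since \<open>T x\<^sup>d - d (d + 1) x\<^sup>d\<close> has degree below \<open>d\<close>, symmetry also makes \<open>L\<^sub>k\<close>
  orthogonal to every polynomial of degree below \<open>k\<close>. One of these is \<open>x L\<^sub>k' - k L\<^sub>k\<close>, whence
  \<open>2 = [x L\<^sub>k\<^sup>2] = \<integral> L\<^sub>k\<^sup>2 + 2 \<integral> x L\<^sub>k L\<^sub>k' = (2 k + 1) \<integral> L\<^sub>k\<^sup>2\<close>.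
\<close>

subsection \<open>Higher derivatives of products\<close>

lemma higher_pderiv_Suc_X_mult:
  fixes p :: "'a::idom poly"
  shows "(pderiv ^^ Suc n) ([:0, 1:] * p) =
         [:0, 1:] * (pderiv ^^ Suc n) p + smult (of_nat (Suc n)) ((pderiv ^^ n) p)"
proof (induction n)
  case 0
  show ?case by (simp add: pderiv_pCons)
next
  case (Suc n)
  from arg_cong[where f = pderiv, OF Suc.IH] show ?case
    by (simp add: pderiv_pCons pderiv_add pderiv_smult poly_eq_iff algebra_simps)
qed

lemma poly_higher_pderiv_linear_power_mult:
  fixes q :: "'a::{idom,semiring_char_0} poly"
  shows "poly ((pderiv ^^ m) ([:- a, 1:] ^ m * q)) a = fact m * poly q a"
proof (induction m arbitrary: q)
  case 0
  show ?case by simp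
next
  case (Suc m)
  have "pderiv ([:- a, 1:] ^ Suc m * q) =
        [:- a, 1:] ^ m * (smult (of_nat (Suc m)) q + [:- a, 1:] * pderiv q)"
    unfolding pderiv_mult pderiv_power_Suc by (simp add: pderiv_pCons algebra_simps)
  with Suc.IH show ?case
    by (simp only: funpow_Suc_right o_apply) (simp add: algebra_simps)
qed

subsection \<open>The Legendre operator\<close>

definition legendre_op :: "'a::idom poly \<Rightarrow> 'a poly" where
  "legendre_op p = pderiv ([:-1, 0, 1:] * pderiv p)"

lemma legendre_op_smult: "legendre_op (smult c p) = smult c (legendre_op p)"
  by (simp only: legendre_op_def pderiv_smult mult_smult_right)

lemma legendre_op_eq:
  "legendre_op p = [:-1, 0, 1:] * pderiv (pderiv p) + smult 2 ([:0, 1:] * pderiv p)"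
  unfolding legendre_op_def pderiv_mult by (simp add: pderiv_pCons)

lemma coeff_legendre_op:
  "coeff (legendre_op p) i =
     of_nat i * (of_nat i + 1) * coeff p i - of_nat (i + 1) * of_nat (i + 2) * coeff p (i + 2)"
  by (simp add: legendre_op_eq coeff_pderiv coeff_pCons algebra_simps split: nat.split)

lemma pderiv_legendre_op:
  "pderiv (legendre_op p) = legendre_op (pderiv p) + smult 2 (pderiv ([:0, 1:] * pderiv p))"
  unfolding legendre_op_eq
  by (simp add: poly_eq_iff coeff_pderiv coeff_pCons algebra_simps split: nat.split)

lemma higher_pderiv_legendre_op:
  "(pderiv ^^ n) (legendre_op p) =
     legendre_op ((pderiv ^^ n) p) + smult (2 * of_nat n) ([:0, 1:] * (pderiv ^^ Suc n) p)
       + smult (of_nat n * (of_nat n + 1)) ((pderiv ^^ n) p)"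
proof (induction n)
  case 0
  show ?case by simp
next
  case (Suc n)
  show ?case
    by (simp add: Suc.IH pderiv_legendre_op pderiv_add pderiv_smult pderiv_pCons
        poly_eq_iff coeff_pCons algebra_simps split: nat.split)
qed

lemma legendre_op_square_minus_one_power:
  "legendre_op ([:-1, 0, 1:] ^ k) =
     smult (2 * of_nat k) (pderiv ([:0, 1:] * [:-1, 0, 1:] ^ k))"
proof -
  have "[:-1, 0, 1:] * pderiv ([:-1, 0, 1::'a:] ^ k)
        = smult (2 * of_nat k) ([:0, 1:] * [:-1, 0, 1:] ^ k)"
  proof (cases k)
    case (Suc j)
    have "pderiv [:-1, 0, 1::'a:] = smult 2 [:0, 1:]"
      by (simp add: pderiv_pCons)
    then show ?thesis
      unfolding Suc pderiv_power_Suc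
      by (simp only: power_Suc mult_smult_left mult_smult_right smult_smult mult_ac)
  qed simp
  then show ?thesis by (simp only: legendre_op_def pderiv_smult)
qed

lemma legendre_op_legendre_poly:
  "legendre_op (legendre_poly k) = smult (real k * (real k + 1)) (legendre_poly k)"
proof -
  define u :: "real poly" where "u = [:-1, 0, 1:] ^ k"
  let ?v = "(pderiv ^^ k) u"
  have "legendre_op ?v + smult (2 * real k) ([:0, 1:] * (pderiv ^^ Suc k) u)
          + smult (real k * (real k + 1)) ?v
        = (pderiv ^^ k) (legendre_op u)"
    by (rule higher_pderiv_legendre_op[symmetric])
  also have "\<dots> = smult (2 * real k) ((pderiv ^^ Suc k) ([:0, 1:] * u))"
    unfolding u_def legendre_op_square_minus_one_power
      higher_pderiv_smult funpow_Suc_right o_apply ..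
  also have "\<dots> = smult (2 * real k) ([:0, 1:] * (pderiv ^^ Suc k) u)
                    + smult (2 * real k * real (Suc k)) ?v"
    by (simp only: higher_pderiv_Suc_X_mult smult_add_right smult_smult)
  finally have "legendre_op ?v = smult (real k * (real k + 1)) ?v"
    by (simp add: poly_eq_iff algebra_simps)
  then show ?thesis
    by (simp only: legendre_poly_def legendre_op_smult smult_smult mult.commute flip: u_def)
qed

subsection \<open>Integrals of real polynomials\<close>

definition poly_integral :: "real \<Rightarrow> real \<Rightarrow> real poly \<Rightarrow> real" where
  "poly_integral a b p = integral {a..b} (poly p)"

lemma has_integral_poly: "(poly p has_integral poly_integral a b p) {a..b}"
  unfolding poly_integral_def
  by (intro integrable_integral integrable_continuous_interval continuous_intros)

lemma poly_integral_add: "poly_integral a b (p + q) = poly_integral a b p + poly_integral a b q"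
  by (rule has_integral_unique[OF has_integral_poly])
     (use has_integral_add[OF has_integral_poly has_integral_poly] in \<open>simp flip: poly_add\<close>)

lemma poly_integral_smult: "poly_integral a b (smult c p) = c * poly_integral a b p"
  by (rule has_integral_unique[OF has_integral_poly])
     (use has_integral_mult_right[OF has_integral_poly] in \<open>simp flip: poly_smult\<close>)

lemma poly_integral_0 [simp]: "poly_integral a b 0 = 0"
  using poly_integral_smult[of a b 0 0] by simp

lemma poly_integral_diff: "poly_integral a b (p - q) = poly_integral a b p - poly_integral a b q"
  using poly_integral_add[of a b "p - q" q] by simp

lemma poly_integral_pderiv:
  assumes "a \<le> b"
  shows "poly_integral a b (pderiv p) = poly p b - poly p a"
  using assms
  by (intro has_integral_unique[OF has_integral_poly] fundamental_theorem_of_calculus)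
     (auto simp flip: has_real_derivative_iff_has_vector_derivative
           intro: DERIV_subset[OF poly_DERIV])

subsection \<open>Green's identity and orthogonality\<close>

lemma poly_integral_legendre_op_mult:
  "poly_integral (-1) 1 (legendre_op p * q) =
     - poly_integral (-1) 1 ([:-1, 0, 1:] * pderiv p * pderiv q)"
proof -
  have "pderiv ([:-1, 0, 1:] * pderiv p * q)
        = [:-1, 0, 1:] * pderiv p * pderiv q + legendre_op p * q"
    by (subst pderiv_mult) (simp only: legendre_op_def mult.commute[of q])
  moreover have "poly_integral (-1) 1 (pderiv ([:-1, 0, 1:] * pderiv p * q)) = 0"
    by (simp add: poly_integral_pderiv)
  ultimately show ?thesis by (simp only: poly_integral_add)
qed

lemma poly_integral_legendre_op_symmetric:
  "poly_integral (-1) 1 (legendre_op p * q) = poly_integral (-1) 1 (p * legendre_op q)"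
  using poly_integral_legendre_op_mult[of p q] poly_integral_legendre_op_mult[of q p]
  by (simp only: mult_ac)

lemma poly_integral_eigen_mult_legendre_op_diff:
  assumes "legendre_op p = smult \<mu> p"
  shows "poly_integral (-1) 1 (p * (legendre_op q - smult \<nu> q)) =
         (\<mu> - \<nu>) * poly_integral (-1) 1 (p * q)"
  using poly_integral_legendre_op_symmetric[of p q]
  by (simp add: assms poly_integral_diff poly_integral_smult algebra_simps)

lemma poly_integral_eigen_orthogonal:
  assumes "legendre_op p = smult \<mu> p" "legendre_op q = smult \<nu> q" "\<mu> \<noteq> \<nu>"
  shows "poly_integral (-1) 1 (p * q) = 0"
  using poly_integral_eigen_mult_legendre_op_diff[OF assms(1), of q \<nu>] assms(2,3)
  by simp

lemma legendre_eigenvalue_eq_iff: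
  "real k * (real k + 1) = real j * (real j + 1) \<longleftrightarrow> k = j"
proof -
  have "strict_mono (\<lambda>k. k * (k + 1 :: nat))"
    by (rule strict_monoI_Suc) simp
  then have "k * (k + 1) = j * (j + 1) \<longleftrightarrow> k = j"
    by (rule strict_mono_eq)
  then show ?thesis
    using of_nat_eq_iff[where 'a = real, of "k * (k + 1)" "j * (j + 1)"]
    by (simp add: algebra_simps)
qed

lemma poly_integral_eigen_mult_low_degree:
  assumes "legendre_op p = smult (real k * (real k + 1)) p"
    and "\<And>i. i \<ge> k \<Longrightarrow> coeff q i = 0"
  shows "poly_integral (-1) 1 (p * q) = 0"
proof -
  have "poly_integral (-1) 1 (p * q) = 0" if "d \<le> k" "\<forall>i\<ge>d. coeff q i = 0" for d
    using that
  proof (induction d arbitrary: q)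
    case 0
    then have "q = 0" by (simp add: poly_eq_iff)
    then show ?case by simp
  next
    case (Suc d)
    let ?c = "real d * (real d + 1)"
    have "coeff (legendre_op q - smult ?c q) i = 0" if "i \<ge> d" for i
      using Suc.prems that by (cases "i = d") (auto simp: coeff_legendre_op)
    then have "(real k * (real k + 1) - ?c) * poly_integral (-1) 1 (p * q) = 0"
      using Suc.IH[of "legendre_op q - smult ?c q"] Suc.prems(1)
      by (simp add: poly_integral_eigen_mult_legendre_op_diff[OF assms(1)])
    then show ?case using Suc.prems(1) by (auto simp: legendre_eigenvalue_eq_iff)
  qed
  then show ?thesis using assms(2) by blast
qed

lemma poly_integral_eigen_square:
  assumes "legendre_op p = smult (real k * (real k + 1)) p" "degree p \<le> k"
  shows "(2 * real k + 1) * poly_integral (-1) 1 (p * p) = (poly p 1)\<^sup>2 + (poly p (-1))\<^sup>2"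
proof -
  define r where "r = [:0, 1:] * pderiv p - smult (real k) p"
  have "coeff r i = 0" if "i \<ge> k" for i
    using that assms(2) unfolding r_def
    by (cases i; cases "i = k") (auto simp: coeff_pderiv coeff_eq_0)
  then have orth: "poly_integral (-1) 1 (p * r) = 0"
    by (rule poly_integral_eigen_mult_low_degree[OF assms(1)])
  have "pderiv ([:0, 1:] * (p * p)) = smult (2 * real k + 1) (p * p) + smult 2 (p * r)"
    unfolding r_def
    by (simp add: pderiv_mult pderiv_pCons algebra_simps
        poly_eq_poly_eq_iff[symmetric] fun_eq_iff)
  then have "(2 * real k + 1) * poly_integral (-1) 1 (p * p)
             = poly_integral (-1) 1 (pderiv ([:0, 1:] * (p * p)))"
    by (simp only: poly_integral_add poly_integral_smult orth)
  also have "\<dots> = (poly p 1)\<^sup>2 + (poly p (-1))\<^sup>2"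
    by (simp add: poly_integral_pderiv power2_eq_square)
  finally show ?thesis .
qed

lemma has_integral_weighted_pderiv_mult:
  "((\<lambda>x. poly ([:-1, 0, 1:] * pderiv p) x * poly ([:-1, 0, 1:] * pderiv q) x / (1 - x\<^sup>2))
     has_integral poly_integral (-1) 1 (legendre_op p * q)) {-1..1}"
proof -
  have "poly ([:-1, 0, 1:] * pderiv p) x * poly ([:-1, 0, 1:] * pderiv q) x / (1 - x\<^sup>2)
        = - poly ([:-1, 0, 1:] * pderiv p * pderiv q) x" for x :: real
    \<comment> \<open>At \<open>x = \<plusminus>1\<close> the quotient is a division by zero, and both sides are \<open>0\<close>.\<close>
    by (cases "x\<^sup>2 = 1") (simp_all add: power2_eq_square field_simps)
  then show ?thesis
    using has_integral_neg[OF has_integral_poly[of "[:-1, 0, 1:] * pderiv p * pderiv q" "-1" 1]]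
    by (simp only: poly_integral_legendre_op_mult)
qed

subsection \<open>Legendre polynomials and their antiderivatives\<close>

lemma degree_legendre_poly: "degree (legendre_poly k) = k"
  by (simp add: legendre_poly_def degree_higher_pderiv degree_power_eq)

lemma poly_legendre_poly_1: "poly (legendre_poly k) 1 = 1"
proof -
  have "[:-1, 0, 1::real:] ^ k = [:- 1, 1:] ^ k * [:1, 1:] ^ k"
    by (simp flip: power_mult_distrib)
  then show ?thesis
    by (simp add: legendre_poly_def poly_higher_pderiv_linear_power_mult)
qed

lemma poly_legendre_poly_minus_1: "poly (legendre_poly k) (-1) = (-1) ^ k"
proof -
  have "[:-1, 0, 1::real:] ^ k = [:- (-1), 1:] ^ k * [:-1, 1:] ^ k"
    by (simp flip: power_mult_distrib)
  then show ?thesis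
    by (simp only: legendre_poly_def poly_smult poly_higher_pderiv_linear_power_mult)
       (simp add: power_minus[of 2])
qed

lemma poly_integral_legendre_poly_mult:
  "poly_integral (-1) 1 (legendre_poly k * legendre_poly j) =
     (if k = j then 2 / (2 * real k + 1) else 0)"
proof (cases "k = j")
  case True
  have "(2 * real k + 1) * poly_integral (-1) 1 (legendre_poly k * legendre_poly k) = 2"
    using poly_integral_eigen_square[OF legendre_op_legendre_poly, of k]
    by (simp add: degree_legendre_poly poly_legendre_poly_1 poly_legendre_poly_minus_1
        flip: power_mult)
  with True show ?thesis by (simp add: field_simps)
next
  case False
  then show ?thesis
    by (simp add: poly_integral_eigen_orthogonal[OF legendre_op_legendre_poly
          legendre_op_legendre_poly] legendre_eigenvalue_eq_iff)
qed

lemma Q_fun_Suc: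
  assumes "k > 0"
  shows "Q_fun (Suc k) x =
         poly ([:-1, 0, 1:] * pderiv (legendre_poly k)) x / (real k * (real k + 1))"
proof -
  let ?F = "smult (1 / (real k * (real k + 1))) ([:-1, 0, 1:] * pderiv (legendre_poly k))"
  have pderiv_F: "pderiv ?F = legendre_poly k"
    using assms legendre_op_legendre_poly[of k]
    by (simp only: pderiv_smult flip: legendre_op_def) simp
  have "(LBINT t=ereal x..ereal 1. poly (legendre_poly k) t) = poly ?F 1 - poly ?F x"
  proof (rule interval_integral_FTC_finite)
    show "(poly ?F has_vector_derivative poly (legendre_poly k) t)
            (at t within {min x 1..max x 1})" for t
      using DERIV_subset[OF poly_DERIV[of ?F t]]
      by (simp only: pderiv_F subset_UNIV flip: has_real_derivative_iff_has_vector_derivative)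
  qed (intro continuous_intros)
  then show ?thesis by (simp add: Q_fun_def)
qed

lemma Q_fun_Suc_mult_has_integral:
  assumes "k > 0" "j > 0"
  shows "((\<lambda>x. Q_fun (Suc k) x * Q_fun (Suc j) x / (1 - x\<^sup>2)) has_integral
           (if k = j then 2 / (real k * (real k + 1) * (2 * real k + 1)) else 0)) {-1..1}"
proof -
  let ?c = "\<lambda>k. real k * (real k + 1)"
  have "poly_integral (-1) 1 (legendre_op (legendre_poly k) * legendre_poly j) / (?c k * ?c j)
        = (if k = j then 2 / (?c k * (2 * real k + 1)) else 0)"
    using assms
    by (simp add: legendre_op_legendre_poly poly_integral_smult poly_integral_legendre_poly_mult)
  then show ?thesis
    using has_integral_divide[OF has_integral_weighted_pderiv_mult, of "legendre_poly k"
        "legendre_poly j" "?c k * ?c j"]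
    by (simp add: Q_fun_Suc assms mult_ac)
qed

theorem proposition1:
  shows "(\<forall>n m :: nat. n \<ge> 2 \<longrightarrow> m \<ge> 2 \<longrightarrow> n \<noteq> m \<longrightarrow>
            ((\<lambda>x::real. Q_fun n x * Q_fun m x / (1 - x\<^sup>2)) has_integral 0) {-1..1})
       \<and> (\<forall>n :: nat. n \<ge> 2 \<longrightarrow>
            ((\<lambda>x::real. (Q_fun n x)\<^sup>2 / (1 - x\<^sup>2)) has_integral
               2 / (real n * (real n - 1) * (2 * real n - 1))) {-1..1})"
proof (intro conjI allI impI)
  fix n m :: nat
  assume "n \<ge> 2" "m \<ge> 2" "n \<noteq> m"
  then show "((\<lambda>x::real. Q_fun n x * Q_fun m x / (1 - x\<^sup>2)) has_integral 0) {-1..1}"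
    using Q_fun_Suc_mult_has_integral[of "n - 1" "m - 1"] by (simp add: eq_diff_iff)
next
  fix n :: nat
  assume "n \<ge> 2"
  then show "((\<lambda>x::real. (Q_fun n x)\<^sup>2 / (1 - x\<^sup>2)) has_integral
               2 / (real n * (real n - 1) * (2 * real n - 1))) {-1..1}"
    using Q_fun_Suc_mult_has_integral[of "n - 1" "n - 1"]
    by (simp add: power2_eq_square mult_ac)
qed

end
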